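(* Let $\mathcal{R}$ be a collection of axis-parallel rectangles and $P$ a set of points such that the piercing graph of $\mathcal{R}$ has chromatic number $k$. Then there is a collection of $k$ planar graphs on $P$ whose union is a support for the hypergraph $(P,\mathcal{R})$, i.e., for every $R\in\mathcal{R}$ the union graph induced on $R\cap P$ is connected.
   Context: The piercing graph of $\mathcal{R}$ has vertex set $\mathcal{R}$ and an edge between two rectangles iff they intersect but neither contains a corner of the other. The hypergraph $(P,\mathcal{R})$ has vertex set $P$ and, for each $R\in\mathcal{R}$, the hyperedge $R\cap P$. Points and rectangles are assumed in general position (distinct coordinates, no point on a rectangle boundary).
   Formalization: The point set P and the collection of rectangles are both assumed finite; without this the claim fails, e.g. for a countable dense P and a countable dense family of squares (piercing graph without edges, k = 1). *)

theory Defs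
  imports "HOL-Analysis.Analysis"
begin

type_synonym point = "real \<times> real"

text \<open>An axis-parallel rectangle is given by (x1, x2, y1, y2) with x1 < x2 and y1 < y2;
  it denotes the open region (x1,x2) x (y1,y2).\<close>
type_synonym rect = "real \<times> real \<times> real \<times> real"

definition rx1 :: "rect \<Rightarrow> real" where "rx1 R = fst R"
definition rx2 :: "rect \<Rightarrow> real" where "rx2 R = fst (snd R)"
definition ry1 :: "rect \<Rightarrow> real" where "ry1 R = fst (snd (snd R))"
definition ry2 :: "rect \<Rightarrow> real" where "ry2 R = snd (snd (snd R))"

definition valid_rect :: "rect \<Rightarrow> bool" where
  "valid_rect R \<longleftrightarrow> rx1 R < rx2 R \<and> ry1 R < ry2 R"

definition in_rect :: "point \<Rightarrow> rect \<Rightarrow> bool" where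
  "in_rect p R \<longleftrightarrow> rx1 R < fst p \<and> fst p < rx2 R \<and> ry1 R < snd p \<and> snd p < ry2 R"

definition rect_set :: "rect \<Rightarrow> point set" where
  "rect_set R = {p. in_rect p R}"

definition corners :: "rect \<Rightarrow> point set" where
  "corners R = {(rx1 R, ry1 R), (rx1 R, ry2 R), (rx2 R, ry1 R), (rx2 R, ry2 R)}"

definition general_position :: "point set \<Rightarrow> rect set \<Rightarrow> bool" where
  "general_position P \<R> \<longleftrightarrow>
     inj_on fst P \<and> inj_on snd P \<and>
     inj_on rx1 \<R> \<and> inj_on rx2 \<R> \<and> inj_on ry1 \<R> \<and> inj_on ry2 \<R> \<and>
     (\<forall>R\<in>\<R>. \<forall>S\<in>\<R>. rx1 R \<noteq> rx2 S \<and> ry1 R \<noteq> ry2 S) \<and>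
     (\<forall>p\<in>P. \<forall>R\<in>\<R>. fst p \<noteq> rx1 R \<and> fst p \<noteq> rx2 R \<and> snd p \<noteq> ry1 R \<and> snd p \<noteq> ry2 R)"

definition piercing_adj :: "rect \<Rightarrow> rect \<Rightarrow> bool" where
  "piercing_adj R S \<longleftrightarrow> R \<noteq> S \<and> rect_set R \<inter> rect_set S \<noteq> {} \<and>
     corners R \<inter> rect_set S = {} \<and> corners S \<inter> rect_set R = {}"

definition proper_colouring :: "'a set \<Rightarrow> ('a \<Rightarrow> 'a \<Rightarrow> bool) \<Rightarrow> nat \<Rightarrow> ('a \<Rightarrow> nat) \<Rightarrow> bool" where
  "proper_colouring V adj k c \<longleftrightarrow>
     (\<forall>v\<in>V. c v < k) \<and> (\<forall>u\<in>V. \<forall>v\<in>V. adj u v \<longrightarrow> c u \<noteq> c v)"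

definition chromatic_number :: "'a set \<Rightarrow> ('a \<Rightarrow> 'a \<Rightarrow> bool) \<Rightarrow> nat" where
  "chromatic_number V adj = (LEAST k. \<exists>c. proper_colouring V adj k c)"

definition simple_graph :: "'a set \<Rightarrow> 'a set set \<Rightarrow> bool" where
  "simple_graph V E \<longleftrightarrow> (\<forall>e\<in>E. \<exists>u v. e = {u, v} \<and> u \<noteq> v \<and> u \<in> V \<and> v \<in> V)"

definition planar_graph :: "'a set \<Rightarrow> 'a set set \<Rightarrow> bool" where
  "planar_graph V E \<longleftrightarrow> simple_graph V E \<and>
     (\<exists>(f :: 'a \<Rightarrow> real \<times> real) (\<gamma> :: 'a set \<Rightarrow> real \<Rightarrow> real \<times> real).
        inj_on f V \<and>
        (\<forall>e\<in>E. arc (\<gamma> e) \<and> {pathstart (\<gamma> e), pathfinish (\<gamma> e)} = f ` e \<and>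
                 path_image (\<gamma> e) \<inter> f ` V = f ` e) \<and>
        (\<forall>e\<in>E. \<forall>e'\<in>E. e \<noteq> e' \<longrightarrow> path_image (\<gamma> e) \<inter> path_image (\<gamma> e') \<subseteq> f ` (e \<inter> e')))"

definition induced_connected :: "'a set \<Rightarrow> 'a set set \<Rightarrow> bool" where
  "induced_connected W E \<longleftrightarrow>
     (\<forall>u\<in>W. \<forall>v\<in>W. (\<lambda>a b. a \<in> W \<and> b \<in> W \<and> {a, b} \<in> E)\<^sup>*\<^sup>* u v)"

end

theory Submission
  imports Defs
begin

text \<open>It suffices to find, for one colour class (a family without piercing pairs), a planar graph
that connects the points inside every rectangle of the class. Start from the pairs of points whose
bounding box contains no other point, drawn as straight segments: two such segments can only cross if
their boxes pierce each other, one being tall and the other wide. Discard a pair if some rectangle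
avoids both its points but contains points on both sides that cross its box, and then discard the tall
pair of every crossing that is left. No crossing survives.

The remaining graph connects the points of each rectangle \<open>R\<close>. Otherwise call a pair of points of
\<open>R\<close> bad if it lies in different components. A bad pair with an empty box was discarded. Suppose some
was discarded because of a tall thin rectangle \<open>S\<close>, and take the narrowest. As \<open>S\<close> does not pierce
\<open>R\<close>, it has points in \<open>R\<close> above (or below) the pair; detouring through the leftmost and rightmost of
them yields a box \<open>Q\<close> in which there is a bad pair. The lowest bad pair in \<open>Q\<close> can only have been
discarded because of a wide crossing pair with no point in \<open>Q\<close>, which then conflicts with \<open>S\<close>, or
because of a tall thin rectangle, contradicting the choice of the narrowest pair. So every bad pair
was discarded because of a wide pair; one of the points of that pair lies in \<open>R\<close>, and this gives a
bad pair of smaller height.\<close>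

section \<open>Betweenness, empty boxes and the reasons for discarding a pair\<close>

definition betw :: "real \<Rightarrow> real \<Rightarrow> real \<Rightarrow> bool" where
  "betw a b x \<longleftrightarrow> a < x \<and> x < b \<or> b < x \<and> x < a"

lemma betw_uminus [simp]: "betw (- a) (- b) (- x) = betw a b x"
  unfolding betw_def by auto

text \<open>Coordinates are parameters so that the reflection in a horizontal line is again an instance.\<close>
locale rect_family =
  fixes P :: "'a set" and F :: "'r set" and X Y :: "'a \<Rightarrow> real"
    and x1 x2 y1 y2 :: "'r \<Rightarrow> real"
  assumes finite_P: "finite P" and inj_X: "inj_on X P" and inj_Y: "inj_on Y P"
    and non_piercing: "\<lbrakk>R \<in> F; S \<in> F; x1 S < x1 R; x2 R < x2 S; y1 R < y1 S; y2 S < y2 R\<rbrakk> \<Longrightarrow> False"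
begin

definition mem :: "'a \<Rightarrow> 'r \<Rightarrow> bool" where
  "mem z R \<longleftrightarrow> x1 R < X z \<and> X z < x2 R \<and> y1 R < Y z \<and> Y z < y2 R"

definition delaunay :: "'a \<Rightarrow> 'a \<Rightarrow> bool" where
  "delaunay p q \<longleftrightarrow> p \<in> P \<and> q \<in> P \<and> p \<noteq> q \<and>
     (\<forall>z\<in>P. \<not> (betw (X p) (X q) (X z) \<and> betw (Y p) (Y q) (Y z)))"

text \<open>The box of the first pair is the tall one, that of the second pair the wide one.\<close>
definition crosses :: "'a \<Rightarrow> 'a \<Rightarrow> 'a \<Rightarrow> 'a \<Rightarrow> bool" where
  "crosses p q r s \<longleftrightarrow> betw (X r) (X s) (X p) \<and> betw (X r) (X s) (X q) \<and>
     betw (Y p) (Y q) (Y r) \<and> betw (Y p) (Y q) (Y s)"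

text \<open>As \<open>S\<close> covers the heights of \<open>p\<close> and \<open>q\<close> but
  misses both points, it runs vertically through the gap between them; \<open>h_cut\<close> is the
  same with the axes exchanged.\<close>

definition v_cut :: "'a \<Rightarrow> 'a \<Rightarrow> bool" where
  "v_cut p q \<longleftrightarrow> (\<exists>S\<in>F. \<exists>s\<in>P. \<exists>t\<in>P.
     mem s S \<and> mem t S \<and> \<not> mem p S \<and> \<not> mem q S \<and> crosses s t p q)"

definition h_cut :: "'a \<Rightarrow> 'a \<Rightarrow> bool" where
  "h_cut p q \<longleftrightarrow> (\<exists>S\<in>F. \<exists>r\<in>P. \<exists>s\<in>P.
     mem r S \<and> mem s S \<and> \<not> mem p S \<and> \<not> mem q S \<and> crosses p q r s)"

definition uncut :: "'a \<Rightarrow> 'a \<Rightarrow> bool" where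
  "uncut p q \<longleftrightarrow> delaunay p q \<and> \<not> v_cut p q \<and> \<not> h_cut p q"

text \<open>The wide pair ranges over \<open>uncut\<close> pairs and not over edges, which keeps the
  definition free of recursion: \<open>r s\<close> may itself be dropped as the tall pair of another
  crossing.\<close>

definition edge :: "'a \<Rightarrow> 'a \<Rightarrow> bool" where
  "edge p q \<longleftrightarrow> uncut p q \<and> (\<forall>r\<in>P. \<forall>s\<in>P. uncut r s \<longrightarrow> \<not> crosses p q r s)"

text \<open>What the two reasons for discarding \<open>p q\<close> because of a wide pair \<open>r s\<close> (a rectangle containing
  \<open>r\<close> and \<open>s\<close> but neither \<open>p\<close> nor \<open>q\<close>, or \<open>r s\<close> being uncut) have in common.\<close>
definition blocks :: "'a \<Rightarrow> 'a \<Rightarrow> 'a \<Rightarrow> 'a \<Rightarrow> bool" where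
  "blocks r s p q \<longleftrightarrow> crosses p q r s \<and>
     (\<forall>S\<in>F. \<forall>a\<in>P. \<forall>b\<in>P. mem a S \<longrightarrow> mem b S \<longrightarrow>
        Y a \<le> Y p \<longrightarrow> Y a \<le> Y q \<longrightarrow> Y p \<le> Y b \<longrightarrow> Y q \<le> Y b \<longrightarrow>
        \<not> (X r \<le> x1 S \<and> x2 S \<le> X s \<or> X s \<le> x1 S \<and> x2 S \<le> X r))"

subsection \<open>Connectivity inside each rectangle\<close>

lemma delaunay_sym: "delaunay p q \<Longrightarrow> delaunay q p"
  unfolding delaunay_def betw_def by blast

lemma crosses_sym: "crosses p q r s \<Longrightarrow> crosses q p r s" "crosses p q r s \<Longrightarrow> crosses p q s r"
  unfolding crosses_def betw_def by blast+

text \<open>A rectangle violating \<open>blocks\<close> is horizontally strictly inside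
  \<open>S\<close>, whereas \<open>S\<close>, holding \<open>r\<close> and \<open>s\<close> but
  missing \<open>p\<close> and \<open>q\<close>, is trapped between the heights of \<open>p\<close>
  and \<open>q\<close>. The two rectangles would pierce.\<close>

lemma h_cut_blocks:
  assumes S: "S \<in> F" "mem r S" "mem s S" "\<not> mem p S" "\<not> mem q S" and c: "crosses p q r s"
  shows "blocks r s p q"
  unfolding blocks_def
proof (intro conjI ballI impI notI c)
  fix R a b
  assume R: "R \<in> F" "mem a R" "mem b R" "Y a \<le> Y p" "Y a \<le> Y q" "Y p \<le> Y b" "Y q \<le> Y b"
    and x: "X r \<le> x1 R \<and> x2 R \<le> X s \<or> X s \<le> x1 R \<and> x2 R \<le> X r"
  have "x1 S < x1 R" "x2 R < x2 S"
    using x S(2,3) unfolding mem_def by linarith+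
  moreover have "y1 R < y1 S" "y2 S < y2 R"
    using S(2-5) c R(2-) unfolding mem_def crosses_def betw_def by (smt (verit))+
  ultimately show False using non_piercing R(1) S(1) by blast
qed

text \<open>In a rectangle violating \<open>blocks\<close>, the points \<open>a\<close> and
  \<open>b\<close> span a tall box across \<open>r s\<close>, and the rectangle misses
  \<open>r\<close> and \<open>s\<close>; it would witness \<open>v_cut r s\<close>.\<close>

lemma uncut_blocks:
  assumes u: "uncut r s" and c: "crosses p q r s"
  shows "blocks r s p q"
  unfolding blocks_def
proof (intro conjI ballI impI notI c)
  fix R a b
  assume R: "R \<in> F" "a \<in> P" "b \<in> P" "mem a R" "mem b R"
      "Y a \<le> Y p" "Y a \<le> Y q" "Y p \<le> Y b" "Y q \<le> Y b"
    and x: "X r \<le> x1 R \<and> x2 R \<le> X s \<or> X s \<le> x1 R \<and> x2 R \<le> X r"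
  have "crosses a b r s"
    using c R x unfolding crosses_def betw_def mem_def by (smt (verit))
  moreover have "\<not> mem r R" "\<not> mem s R" using x unfolding mem_def by linarith+
  ultimately have "v_cut r s" unfolding v_cut_def using R by blast
  then show False using u unfolding uncut_def by blast
qed

lemma not_edge:
  assumes "delaunay p q" "\<not> edge p q" "\<not> v_cut p q"
  obtains r s where "r \<in> P" "s \<in> P" "blocks r s p q"
proof (cases "h_cut p q")
  case True
  then show ?thesis using that h_cut_blocks unfolding h_cut_def by blast
next
  case False
  then obtain r s where "r \<in> P" "s \<in> P" "uncut r s" "crosses p q r s"
    using assms unfolding edge_def uncut_def by blast
  then show ?thesis using that uncut_blocks by blast
qed

text \<open>The heights of \<open>r\<close> and \<open>s\<close> are within \<open>R\<close>, so if
  \<open>R\<close> missed both it would be squeezed horizontally between them. Then \<open>p\<close>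
  and \<open>q\<close> themselves, in order of height, contradict \<open>blocks\<close>.\<close>

lemma blocks_meets:
  assumes "R \<in> F" "mem p R" "mem q R" "p \<in> P" "q \<in> P" and b: "blocks r s p q"
  shows "mem r R \<or> mem s R"
proof (rule ccontr)
  assume n: "\<not> (mem r R \<or> mem s R)"
  have c: "crosses p q r s" using b unfolding blocks_def by blast
  have x: "X r \<le> x1 R \<and> x2 R \<le> X s \<or> X s \<le> x1 R \<and> x2 R \<le> X r"
    using n c assms(2,3) unfolding mem_def crosses_def betw_def by (smt (verit))
  show False
  proof (cases "Y p \<le> Y q")
    case True
    then show False using x assms unfolding blocks_def by blast
  next
    case False
    then have "Y q \<le> Y p" by simp
    then show False using x assms unfolding blocks_def by blast
  qed
qed

text \<open>\<open>T\<close> stands for reachability. In a bad pair of least height difference, a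
  point of \<open>Q\<close> at an intermediate height would by transitivity give a bad pair of
  smaller height; \<open>conv\<close> turns this into an empty box with respect to all of
  \<open>P\<close>.\<close>

lemma lowest_bad_pair:
  assumes T: "transp T" and Q: "Q \<subseteq> P"
    and conv: "\<And>c d z. \<lbrakk>c \<in> Q; d \<in> Q; z \<in> P; betw (X c) (X d) (X z); betw (Y c) (Y d) (Y z)\<rbrakk> \<Longrightarrow> z \<in> Q"
    and ab: "a \<in> Q" "b \<in> Q" "\<not> T a b" and T_refl: "\<And>a. a \<in> Q \<Longrightarrow> T a a"
  obtains c d where "c \<in> Q" "d \<in> Q" "\<not> T c d" "delaunay c d"
    "\<And>z. z \<in> Q \<Longrightarrow> \<not> betw (Y c) (Y d) (Y z)"
proof -
  define B where "B = {e \<in> Q \<times> Q. \<not> T (fst e) (snd e)}"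
  have "finite Q" using Q finite_P finite_subset by blast
  then have fin: "finite B" unfolding B_def by simp
  have ne: "B \<noteq> {}" using ab unfolding B_def by force
  define e where "e = arg_min_on (\<lambda>e. \<bar>Y (fst e) - Y (snd e)\<bar>) B"
  obtain c d where e: "e = (c, d)" by fastforce
  have "e \<in> B" and min: "\<And>e'. e' \<in> B \<Longrightarrow> \<not> \<bar>Y (fst e') - Y (snd e')\<bar> < \<bar>Y c - Y d\<bar>"
    using arg_min_if_finite[OF fin ne, of "\<lambda>e. \<bar>Y (fst e) - Y (snd e)\<bar>"]
    unfolding e_def[symmetric] e by auto
  then have cd: "c \<in> Q" "d \<in> Q" "\<not> T c d" unfolding B_def e by auto
  have nz: "\<not> betw (Y c) (Y d) (Y z)" if "z \<in> Q" for z
  proof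
    assume bz: "betw (Y c) (Y d) (Y z)"
    have "\<not> T c z \<or> \<not> T z d" using cd(3) T by (meson transpE)
    then have "(c, z) \<in> B \<or> (z, d) \<in> B" using cd that unfolding B_def by auto
    then show False using min[of "(c, z)"] min[of "(z, d)"] bz unfolding betw_def by auto
  qed
  have "delaunay c d"
    unfolding delaunay_def using nz conv cd Q T_refl by blast
  then show thesis using that cd nz by blast
qed

text \<open>By \<open>up\<close>, the points of \<open>S\<close> above \<open>p\<close> and
  \<open>q\<close> lie in \<open>R\<close>, and a detour through them must contain a bad step. A
  wide pair blocking the lowest bad pair in the box of that step would have to straddle
  \<open>S\<close>, which \<open>blocks\<close> forbids.\<close>

lemma narrower_bad_pair_above:
  assumes T: "transp T" "symp T" and T_refl: "\<And>a. a \<in> P \<Longrightarrow> mem a R \<Longrightarrow> T a a"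
    and R: "R \<in> F" "mem p R" "mem q R" and d: "delaunay p q" and bad: "\<not> T p q"
    and S: "S \<in> F" "s \<in> P" "t \<in> P" "mem s S" "mem t S" "\<not> mem p S" "\<not> mem q S"
    and cr: "crosses s t p q" and st: "Y t < Y s" and pq: "X p < X q" and up: "y2 S \<le> y2 R"
  shows "\<exists>c d. mem c R \<and> mem d R \<and> delaunay c d \<and> \<not> T c d \<and> \<bar>X c - X d\<bar> < \<bar>X p - X q\<bar> \<and>
    (\<forall>r\<in>P. \<forall>s\<in>P. \<not> blocks r s c d)"
proof -
  have pP: "p \<in> P" "q \<in> P" using d unfolding delaunay_def by auto
  have Y: "Y t < Y p" "Y t < Y q" "Y p < Y s" "Y q < Y s"
    using cr st unfolding crosses_def betw_def by auto
  have Sx: "X p \<le> x1 S" "x2 S \<le> X q"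
    using S(4-7) cr pq Y unfolding mem_def crosses_def betw_def by (smt (verit))+
  define A where "A = {a \<in> P. mem a S \<and> Y p < Y a \<and> Y q < Y a}"
  have finA: "finite A" "A \<noteq> {}" using finite_P S Y unfolding A_def by auto
  have AR: "mem a R" if "a \<in> A" for a
    using that Sx up R unfolding A_def mem_def by auto
  define m where "m = min (Y p) (Y q)"
  \<comment> \<open>The box of \<open>p q\<close> is empty and spans the horizontal range of
    \<open>S\<close>, so a point in that range above the lower of \<open>p\<close>, \<open>q\<close>
    is above both.\<close>
  have mem_A: "z \<in> A" if "z \<in> P" "x1 S < X z" "X z < x2 S" "m < Y z" "a \<in> A" "Y z \<le> Y a" for z a
  proof -
    have "mem z S" using that S(5) Y unfolding A_def mem_def m_def by auto
    moreover have "\<not> betw (Y p) (Y q) (Y z)"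
      using d that Sx unfolding delaunay_def betw_def by (smt (verit))
    moreover have "Y z \<noteq> Y p" "Y z \<noteq> Y q"
      using inj_onD[OF inj_Y] that pP Sx by fastforce+
    ultimately show ?thesis using that unfolding A_def m_def betw_def by auto
  qed
  obtain l where l: "l \<in> A" "\<And>a. a \<in> A \<Longrightarrow> X l \<le> X a"
    using arg_min_if_finite[OF finA, of X] by (meson not_le)
  obtain u where u: "u \<in> A" "\<And>a. a \<in> A \<Longrightarrow> X a \<le> X u"
    using arg_min_if_finite[OF finA, of "\<lambda>a. - X a"] by (meson not_le neg_less_iff_less)
  have lu: "x1 S < X l" "X l \<le> X u" "X u < x2 S" "l \<in> P" "u \<in> P"
    "Y p < Y l" "Y q < Y l" "Y p < Y u" "Y q < Y u" using l u unfolding A_def mem_def by auto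
  \<comment> \<open>The order \<open>p\<close>, \<open>u\<close>, \<open>l\<close>, \<open>q\<close>
    matters: every step has left end \<open>p\<close> or \<open>l\<close> and right end
    \<open>u\<close> or \<open>q\<close>, so no point of \<open>A\<close> lies horizontally outside
    the box of a step.\<close>
  have "\<not> T p u \<or> \<not> T l u \<or> \<not> T l q" using bad T by (meson sympE transpE)
  then obtain a b where ab: "a = p \<or> a = l" "b = q \<or> b = u" "a = l \<or> b = u" "\<not> T a b" by blast
  have abx: "X a \<le> X b" using ab(1-3) lu Sx by auto
  have aby: "m \<le> Y a" "m \<le> Y b" using ab(1,2) lu unfolding m_def by auto
  \<comment> \<open>\<open>w\<close> and \<open>t\<close> will be the upper and lower points of
    \<open>S\<close> that contradict \<open>blocks\<close>.\<close>
  obtain w where w: "w \<in> A" "Y a \<le> Y w" "Y b \<le> Y w"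
    using ab(1-3) l u lu by (metis linear less_imp_le)
  define M where "M = max (Y a) (Y b)"
  define m' where "m' = min (Y a) (Y b)"
  define Q where "Q = {z \<in> P. X a \<le> X z \<and> X z \<le> X b \<and> m' \<le> Y z \<and> Y z \<le> M}"
  have abR: "a \<in> Q" "b \<in> Q" "mem a R" "mem b R"
    using ab(1,2) l(1) u(1) AR R(2,3) lu pP abx unfolding Q_def M_def m'_def by auto
  have QR: "z \<in> P \<and> mem z R" if "z \<in> Q" for z
    using that abR(3,4) unfolding Q_def mem_def M_def m'_def by auto
  obtain c e where ce: "c \<in> Q" "e \<in> Q" "\<not> T c e" "delaunay c e"
    "\<And>z. z \<in> Q \<Longrightarrow> \<not> betw (Y c) (Y e) (Y z)"
  proof (rule lowest_bad_pair[OF T(1) _ _ abR(1,2) ab(4)])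
    show "Q \<subseteq> P" unfolding Q_def by blast
    show "z \<in> Q" if "c \<in> Q" "e \<in> Q" "z \<in> P" "betw (X c) (X e) (X z)" "betw (Y c) (Y e) (Y z)" for c e z
      using that unfolding Q_def betw_def by auto
    show "T z z" if "z \<in> Q" for z using T_refl QR that by blast
  qed blast
  have "\<not> blocks r v c e" if rv: "r \<in> P" "v \<in> P" for r v
  proof
    assume bl: "blocks r v c e"
    have "\<exists>r\<in>P. \<exists>v\<in>P. blocks r v c e \<and> X r < X v"
    proof (cases "X r < X v")
      case False
      have "crosses c e r v" using bl unfolding blocks_def by blast
      then have "X v < X r" using False unfolding crosses_def betw_def by auto
      moreover have "blocks v r c e" using bl crosses_sym unfolding blocks_def by blast
      ultimately show ?thesis using rv by blast
    qed (use bl rv in blast)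
    then obtain r v where rv: "r \<in> P" "v \<in> P" "X r < X v" and bl: "blocks r v c e" by blast
    have crv: "crosses c e r v" using bl unfolding blocks_def by blast
    \<comment> \<open>The heights of \<open>r\<close> and \<open>v\<close> are strictly between
      those of \<open>c\<close> and \<open>e\<close>, so minimality keeps them out of
      \<open>Q\<close>; they can only leave it sideways.\<close>
    have "r \<notin> Q" "v \<notin> Q" using ce(5) crv unfolding crosses_def by blast+
    moreover have y: "m' < Y r" "Y r < M" "m' < Y v" "Y v < M"
      using crv ce(1,2) unfolding crosses_def betw_def Q_def by auto
    moreover have "X r < X c" "X c < X v"
      using crv rv(3) unfolding crosses_def betw_def by auto
    ultimately have x: "X r < X a" "X b < X v" using ce(1) rv(1,2) unfolding Q_def by auto
    have yw: "m < Y r" "Y r \<le> Y w" "m < Y v" "Y v \<le> Y w"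
      using y aby w unfolding m'_def M_def by auto
    \<comment> \<open>Within the range of \<open>S\<close>, \<open>r\<close> would belong to
      \<open>A\<close> and lie left of its leftmost point \<open>l\<close>, or else left of
      \<open>p\<close>; symmetrically for \<open>v\<close> below.\<close>
    have "X r \<le> x1 S"
    proof (rule ccontr)
      assume "\<not> X r \<le> x1 S"
      moreover have "X r < x2 S" using x ab(1) lu Sx by auto
      ultimately have "r \<in> A" using mem_A[OF rv(1) _ _ yw(1) w(1) yw(2)] by auto
      then show False using l(2)[of r] x ab(1) Sx \<open>\<not> X r \<le> x1 S\<close> by auto
    qed
    moreover have "x2 S \<le> X v"
    proof (rule ccontr)
      assume "\<not> x2 S \<le> X v"
      moreover have "x1 S < X v" using x ab(2) lu Sx by auto
      ultimately have "v \<in> A" using mem_A[OF rv(2) _ _ yw(3) w(1) yw(4)] by auto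
      then show False using u(2)[of v] x ab(2) Sx \<open>\<not> x2 S \<le> X v\<close> by auto
    qed
    moreover have "Y t \<le> Y c" "Y t \<le> Y e" "Y c \<le> Y w" "Y e \<le> Y w"
      using ce(1,2) aby w Y unfolding Q_def M_def m'_def m_def by auto
    moreover have "w \<in> P" "mem w S" using w unfolding A_def by auto
    ultimately show False using bl S unfolding blocks_def by blast
  qed
  moreover have "\<bar>X c - X e\<bar> < \<bar>X p - X q\<bar>"
    using ce(1,2) ab(1-3) lu Sx pq unfolding Q_def by auto
  ultimately show ?thesis using ce QR by blast
qed

lemma narrower_bad_pair_below:
  assumes T: "transp T" "symp T" and T_refl: "\<And>a. a \<in> P \<Longrightarrow> mem a R \<Longrightarrow> T a a"
    and R: "R \<in> F" "mem p R" "mem q R" and d: "delaunay p q" and bad: "\<not> T p q"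
    and S: "S \<in> F" "s \<in> P" "t \<in> P" "mem s S" "mem t S" "\<not> mem p S" "\<not> mem q S"
    and cr: "crosses s t p q" and st: "Y s < Y t" and pq: "X p < X q" and low: "y1 R \<le> y1 S"
  shows "\<exists>c d. mem c R \<and> mem d R \<and> delaunay c d \<and> \<not> T c d \<and> \<bar>X c - X d\<bar> < \<bar>X p - X q\<bar> \<and>
    (\<forall>r\<in>P. \<forall>s\<in>P. \<not> blocks r s c d)"
proof -
  \<comment> \<open>Reflection in a horizontal line exchanges the lower and upper sides of each
    rectangle, with signs changed, and preserves all notions in the statement.\<close>
  interpret refl: rect_family P F X "\<lambda>z. - Y z" x1 x2 "\<lambda>R. - y2 R" "\<lambda>R. - y1 R"
  proof
    show "inj_on (\<lambda>z. - Y z) P" using inj_Y unfolding inj_on_def by auto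
  qed (use finite_P inj_X non_piercing in auto)
  have eqs: "refl.mem = mem" "refl.delaunay = delaunay" "refl.crosses = crosses"
    unfolding fun_eq_iff refl.mem_def mem_def refl.delaunay_def delaunay_def
      refl.crosses_def crosses_def by auto
  have "refl.blocks r s c d = blocks r s c d" for r s c d
    unfolding refl.blocks_def blocks_def eqs by auto
  then show ?thesis
    using refl.narrower_bad_pair_above[of T R p q S s t, unfolded eqs, OF T T_refl R d bad S cr _ pq]
      st low by auto
qed

lemma narrower_bad_pair:
  assumes T: "transp T" "symp T" and T_refl: "\<And>a. a \<in> P \<Longrightarrow> mem a R \<Longrightarrow> T a a"
    and R: "R \<in> F" "mem p R" "mem q R" and d: "delaunay p q" and bad: "\<not> T p q" and cut: "v_cut p q"
  shows "\<exists>c d. mem c R \<and> mem d R \<and> delaunay c d \<and> \<not> T c d \<and> \<bar>X c - X d\<bar> < \<bar>X p - X q\<bar> \<and>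
    (\<forall>r\<in>P. \<forall>s\<in>P. \<not> blocks r s c d)"
proof -
  let ?narrower = "\<lambda>p q. \<exists>c d. mem c R \<and> mem d R \<and> delaunay c d \<and> \<not> T c d \<and>
    \<bar>X c - X d\<bar> < \<bar>X p - X q\<bar> \<and> (\<forall>r\<in>P. \<forall>s\<in>P. \<not> blocks r s c d)"
  \<comment> \<open>The case of \<open>p\<close> to the left of \<open>q\<close>; the other follows
    by exchanging the points.\<close>
  have *: "?narrower p q" if d: "delaunay p q" and bad: "\<not> T p q" and cut: "v_cut p q" and pq: "X p < X q"
      and R': "mem p R" "mem q R" for p q
  proof -
    have "\<exists>S\<in>F. \<exists>s\<in>P. \<exists>t\<in>P. mem s S \<and> mem t S \<and> \<not> mem p S \<and> \<not> mem q S \<and>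
        crosses s t p q \<and> Y t < Y s"
    proof -
      obtain S s t where S: "S \<in> F" "s \<in> P" "t \<in> P" "mem s S" "mem t S" "\<not> mem p S" "\<not> mem q S"
        and cr: "crosses s t p q" using cut unfolding v_cut_def by blast
      consider "Y t < Y s" | "Y s < Y t" using cr unfolding crosses_def betw_def by linarith
      then show ?thesis
      proof cases
        case 1
        then show ?thesis using S cr by blast
      next
        case 2
        then show ?thesis using S crosses_sym(1)[OF cr] by blast
      qed
    qed
    then obtain S s t where S: "S \<in> F" "s \<in> P" "t \<in> P" "mem s S" "mem t S" "\<not> mem p S" "\<not> mem q S"
      and cr: "crosses s t p q" and st: "Y t < Y s" by blast
    have S': "S \<in> F" "t \<in> P" "s \<in> P" "mem t S" "mem s S" "\<not> mem p S" "\<not> mem q S" using S by auto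
    have Y: "y1 S < Y p" "Y p < y2 S" "y1 S < Y q" "Y q < y2 S" "X p < X s" "X s < X q"
      using S(4,5) cr st pq unfolding crosses_def betw_def mem_def by auto
    have "X p \<le> x1 S" "x2 S \<le> X q"
      using S(4,6,7) Y unfolding mem_def by auto
    then have "x1 R < x1 S" "x2 S < x2 R" using R' unfolding mem_def by auto
    \<comment> \<open>\<open>S\<close> is horizontally strictly inside \<open>R\<close>, so sticking
      out both above and below would make the two pierce.\<close>
    then consider "y2 S \<le> y2 R" | "y1 R \<le> y1 S" using non_piercing[OF S(1) R(1)] by (meson not_le)
    then show ?thesis
    proof cases
      case 1
      then show ?thesis
        using narrower_bad_pair_above[OF T T_refl R(1) R' d bad S cr st pq] by blast
    next
      case 2
      then show ?thesis
        using narrower_bad_pair_below[OF T T_refl R(1) R' d bad S' crosses_sym(1)[OF cr] st pq] by blast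
    qed
  qed
  show ?thesis
  proof (cases "X p < X q")
    case True
    then show ?thesis using *[OF d bad cut] R by blast
  next
    case False
    moreover have "X p \<noteq> X q" using d inj_onD[OF inj_X] unfolding delaunay_def by blast
    moreover have "v_cut q p" using cut crosses_sym(2) unfolding v_cut_def by blast
    moreover have "\<not> T q p" using bad T(2) by (meson sympE)
    ultimately show ?thesis using *[of q p] delaunay_sym[OF d] R by (auto simp: abs_minus_commute)
  qed
qed

text \<open>Descent on the width: the narrowest such pair yields a narrower bad pair that nothing
  blocks. That pair is no edge, so by \<open>not_edge\<close> it is again cut by a tall
  rectangle.\<close>

lemma no_bad_v_cut:
  assumes T: "transp T" "symp T" and T_refl: "\<And>a. a \<in> P \<Longrightarrow> mem a R \<Longrightarrow> T a a"
    and edges: "\<And>a b. edge a b \<Longrightarrow> mem a R \<Longrightarrow> mem b R \<Longrightarrow> T a b"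
    and R: "R \<in> F" and p: "mem p R" "mem q R" "delaunay p q" "\<not> T p q"
  shows "\<not> v_cut p q"
proof
  assume "v_cut p q"
  define B where "B = {e \<in> P \<times> P. mem (fst e) R \<and> mem (snd e) R \<and> delaunay (fst e) (snd e) \<and>
    \<not> T (fst e) (snd e) \<and> v_cut (fst e) (snd e)}"
  have fin: "finite B" using finite_P unfolding B_def by simp
  have "(p, q) \<in> B" using p \<open>v_cut p q\<close> unfolding B_def by (auto simp: delaunay_def)
  then have ne: "B \<noteq> {}" by blast
  obtain e where e: "e \<in> B" "\<And>e'. e' \<in> B \<Longrightarrow> \<not> \<bar>X (fst e') - X (snd e')\<bar> < \<bar>X (fst e) - X (snd e)\<bar>"
    using arg_min_if_finite[OF fin ne, of "\<lambda>e. \<bar>X (fst e) - X (snd e)\<bar>"] by blast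
  have e': "mem (fst e) R" "mem (snd e) R" "delaunay (fst e) (snd e)" "\<not> T (fst e) (snd e)"
    "v_cut (fst e) (snd e)" using e(1) unfolding B_def by auto
  obtain c d where cd: "mem c R" "mem d R" "delaunay c d" "\<not> T c d"
    and less: "\<bar>X c - X d\<bar> < \<bar>X (fst e) - X (snd e)\<bar>"
    and nb: "\<forall>r\<in>P. \<forall>s\<in>P. \<not> blocks r s c d"
    using narrower_bad_pair[OF T T_refl R e'] by blast
  have "\<not> edge c d" using cd edges by blast
  then have "v_cut c d" using not_edge[OF cd(3)] nb by blast
  then have "(c, d) \<in> B" using cd unfolding B_def by (auto simp: delaunay_def)
  then show False using e(2) less by fastforce
qed

text \<open>Keeping \<open>T\<close> abstract lets it be reachability in any graph containing the
  edges inside \<open>R\<close>. The lowest bad pair of \<open>R\<close> must be blocked, and a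
  blocking point inside \<open>R\<close> has an intermediate height.\<close>

theorem edge_support:
  assumes T: "transp T" "symp T" and T_refl: "\<And>a. a \<in> P \<Longrightarrow> mem a R \<Longrightarrow> T a a"
    and edges: "\<And>a b. edge a b \<Longrightarrow> mem a R \<Longrightarrow> mem b R \<Longrightarrow> T a b"
    and R: "R \<in> F" and ab: "a \<in> P" "b \<in> P" "mem a R" "mem b R"
  shows "T a b"
proof (rule ccontr)
  assume bad: "\<not> T a b"
  define Q where "Q = {z \<in> P. mem z R}"
  have Q: "a \<in> Q" "b \<in> Q" using ab unfolding Q_def by auto
  obtain c d where cd: "c \<in> Q" "d \<in> Q" "\<not> T c d" "delaunay c d"
    "\<And>z. z \<in> Q \<Longrightarrow> \<not> betw (Y c) (Y d) (Y z)"
  proof (rule lowest_bad_pair[OF T(1) _ _ Q bad])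
    show "Q \<subseteq> P" unfolding Q_def by blast
    show "z \<in> Q" if "c \<in> Q" "d \<in> Q" "z \<in> P" "betw (X c) (X d) (X z)" "betw (Y c) (Y d) (Y z)" for c d z
      using that unfolding Q_def betw_def mem_def by auto
    show "T z z" if "z \<in> Q" for z using T_refl that unfolding Q_def by blast
  qed blast
  have m: "mem c R" "mem d R" "c \<in> P" "d \<in> P" using cd unfolding Q_def by auto
  have "\<not> v_cut c d" using no_bad_v_cut[OF T T_refl edges R m(1,2) cd(4,3)] by blast
  moreover have "\<not> edge c d" using edges m cd by blast
  ultimately obtain r s where rs: "r \<in> P" "s \<in> P" "blocks r s c d" using not_edge cd(4) by blast
  then have "r \<in> Q \<or> s \<in> Q" using blocks_meets[OF R m] unfolding Q_def by blast
  then show False using cd(5) rs(3) unfolding blocks_def crosses_def by blast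
qed

lemma edges_not_cross:
  assumes "edge p q" "edge r s"
  shows "\<not> crosses p q r s"
  using assms unfolding edge_def uncut_def delaunay_def by blast

end

subsection \<open>Straight-line drawing\<close>

text \<open>The line through \<open>p\<close> and \<open>q\<close> as a function of the abscissa;
  for equal abscissae, division by zero makes it constantly \<open>snd p\<close>.\<close>

definition chord :: "point \<Rightarrow> point \<Rightarrow> real \<Rightarrow> real" where
  "chord p q x = snd p + (snd q - snd p) / (fst q - fst p) * (x - fst p)"

lemma chord_start [simp]: "chord p q (fst p) = snd p"
  and chord_finish: "fst p < fst q \<Longrightarrow> chord p q (fst q) = snd q"
  unfolding chord_def by auto

text \<open>Linear interpolation with denominators cleared; it transfers comparisons of two chords
  between the ends and the interior of a common range.\<close>

lemma chord_affine: "(b - a) * chord p q x = (b - x) * chord p q a + (x - a) * chord p q b"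
  unfolding chord_def by (simp only: algebra_simps)

lemma closed_segment_iff_chord:
  assumes "fst p < fst q"
  shows "z \<in> closed_segment p q \<longleftrightarrow> fst p \<le> fst z \<and> fst z \<le> fst q \<and> snd z = chord p q (fst z)"
proof
  assume "z \<in> closed_segment p q"
  then obtain u where u: "0 \<le> u" "u \<le> 1" "z = (1 - u) *\<^sub>R p + u *\<^sub>R q"
    unfolding closed_segment_def by blast
  have fz: "fst z = fst p + u * (fst q - fst p)" and sz: "snd z = snd p + u * (snd q - snd p)"
    unfolding u(3) by (simp_all add: algebra_simps)
  have "u * (fst q - fst p) \<le> 1 * (fst q - fst p)" "0 \<le> u * (fst q - fst p)"
    using u assms by (intro mult_right_mono mult_nonneg_nonneg; simp)+
  then have "fst p \<le> fst z" "fst z \<le> fst q" using fz by auto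
  moreover have "snd z = chord p q (fst z)"
    using assms unfolding fz sz chord_def by simp
  ultimately show "fst p \<le> fst z \<and> fst z \<le> fst q \<and> snd z = chord p q (fst z)" by blast
next
  assume z: "fst p \<le> fst z \<and> fst z \<le> fst q \<and> snd z = chord p q (fst z)"
  define u where "u = (fst z - fst p) / (fst q - fst p)"
  have "0 \<le> u" "u \<le> 1" using z assms unfolding u_def by auto
  moreover have "fst z = (1 - u) * fst p + u * fst q"
  proof -
    have "u * (fst q - fst p) = fst z - fst p" using assms unfolding u_def by simp
    then show ?thesis by (simp add: algebra_simps)
  qed
  moreover have "snd z = (1 - u) * snd p + u * snd q"
  proof -
    have "snd z = snd p + u * (snd q - snd p)" using z unfolding u_def chord_def by simp
    then show ?thesis by (simp add: algebra_simps)
  qed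
  ultimately show "z \<in> closed_segment p q"
    unfolding closed_segment_def by (auto intro!: exI[of _ u] prod_eqI)
qed

lemma chord_bounds:
  assumes "fst p \<le> x" "x \<le> fst q" "fst p < fst q"
  shows "min (snd p) (snd q) \<le> chord p q x" "chord p q x \<le> max (snd p) (snd q)"
proof -
  have eq: "(fst q - fst p) * chord p q x = (fst q - x) * snd p + (x - fst p) * snd q"
    using chord_affine[of "fst q" "fst p" p q x] chord_finish[OF assms(3)] by simp
  have "(fst q - fst p) * min (snd p) (snd q) = (fst q - x) * min (snd p) (snd q) + (x - fst p) * min (snd p) (snd q)"
    by (simp add: algebra_simps)
  also have "\<dots> \<le> (fst q - fst p) * chord p q x"
    unfolding eq using assms by (intro add_mono mult_left_mono) auto
  finally show "min (snd p) (snd q) \<le> chord p q x" using assms(3) by simp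
  have "(fst q - fst p) * chord p q x \<le> (fst q - x) * max (snd p) (snd q) + (x - fst p) * max (snd p) (snd q)"
    unfolding eq using assms by (intro add_mono mult_left_mono) auto
  also have "\<dots> = (fst q - fst p) * max (snd p) (snd q)" by (simp add: algebra_simps)
  finally show "chord p q x \<le> max (snd p) (snd q)" using assms(3) by simp
qed

section \<open>Segments of non-crossing pairs meet only in common endpoints\<close>

locale planar_rect_family = rect_family P F fst snd x1 x2 y1 y2
  for P :: "point set" and F :: "'r set" and x1 x2 y1 y2 :: "'r \<Rightarrow> real"
begin

text \<open>The chord never drops below the lower endpoint, so \<open>z\<close> is above that
  endpoint; as the box is empty, \<open>z\<close> must be above both.\<close>

lemma delaunay_above:
  assumes d: "delaunay p q" and pq: "fst p < fst q" and z: "z \<in> P" "fst p \<le> fst z" "fst z \<le> fst q"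
    and above: "chord p q (fst z) < snd z"
  shows "fst p < fst z \<and> fst z < fst q \<and> snd p < snd z \<and> snd q < snd z"
proof -
  have P: "p \<in> P" "q \<in> P" using d unfolding delaunay_def by auto
  have "z \<noteq> p" "z \<noteq> q" using above chord_finish[OF pq] by auto
  then have "fst z \<noteq> fst p" "fst z \<noteq> fst q" "snd z \<noteq> snd p" "snd z \<noteq> snd q"
    using P z inj_X inj_Y unfolding inj_on_def by blast+
  moreover have "min (snd p) (snd q) < snd z" using chord_bounds[OF z(2,3) pq] above by simp
  ultimately show ?thesis using d z unfolding delaunay_def betw_def by force
qed

lemma delaunay_below:
  assumes d: "delaunay p q" and pq: "fst p < fst q" and z: "z \<in> P" "fst p \<le> fst z" "fst z \<le> fst q"
    and below: "snd z < chord p q (fst z)"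
  shows "fst p < fst z \<and> fst z < fst q \<and> snd z < snd p \<and> snd z < snd q"
proof -
  have P: "p \<in> P" "q \<in> P" using d unfolding delaunay_def by auto
  have "z \<noteq> p" "z \<noteq> q" using below chord_finish[OF pq] by auto
  then have "fst z \<noteq> fst p" "fst z \<noteq> fst q" "snd z \<noteq> snd p" "snd z \<noteq> snd q"
    using P z inj_X inj_Y unfolding inj_on_def by blast+
  moreover have "snd z < max (snd p) (snd q)" using chord_bounds[OF z(2,3) pq] below by simp
  ultimately show ?thesis using d z unfolding delaunay_def betw_def by force
qed

lemma delaunay_segment_Int:
  assumes d: "delaunay p q" and pq: "fst p < fst q" and z: "z \<in> P" "z \<in> closed_segment p q"
  shows "z = p \<or> z = q"
proof (rule ccontr)
  assume n: "\<not> (z = p \<or> z = q)"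
  have P: "p \<in> P" "q \<in> P" using d unfolding delaunay_def by auto
  have ne: "fst z \<noteq> fst p" "fst z \<noteq> fst q" "snd z \<noteq> snd p" "snd z \<noteq> snd q"
    using n P z inj_X inj_Y unfolding inj_on_def by blast+
  have z': "fst p \<le> fst z" "fst z \<le> fst q" "snd z = chord p q (fst z)"
    using z(2) closed_segment_iff_chord[OF pq] by auto
  then have "min (snd p) (snd q) \<le> snd z" "snd z \<le> max (snd p) (snd q)"
    using chord_bounds[OF z'(1,2) pq] by auto
  then have "betw (snd p) (snd q) (snd z)" "betw (fst p) (fst q) (fst z)"
    using ne z' unfolding betw_def by auto
  then show False using d z(1) unfolding delaunay_def by blast
qed

text \<open>Each end of the common range is an endpoint of one segment lying off the other chord,
  hence above or below the whole box of the other pair.\<close>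

lemma chords_swap_crosses:
  assumes d: "delaunay p q" "delaunay r s" and pq: "fst p < fst q" and rs: "fst r < fst s"
    and a: "a = max (fst p) (fst r)" and b: "b = min (fst q) (fst s)" and ab: "a < b"
    and lo: "chord p q a < chord r s a" and hi: "chord r s b < chord p q b"
  shows "crosses p q r s \<or> crosses r s p q"
proof -
  have P: "p \<in> P" "q \<in> P" "r \<in> P" "s \<in> P" using d unfolding delaunay_def by auto
  note above = delaunay_above[OF d(1) pq] delaunay_above[OF d(2) rs]
  note below = delaunay_below[OF d(1) pq] delaunay_below[OF d(2) rs]
  have left: "a = fst r \<and> fst p < fst r \<and> snd p < snd r \<and> snd q < snd r \<or>
      a = fst p \<and> fst r < fst p \<and> snd p < snd r \<and> snd p < snd s"
  proof (cases "fst p \<le> fst r")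
    case True
    then show ?thesis using above(1)[OF P(3)] lo a ab b by auto
  next
    case False
    then show ?thesis using below(2)[OF P(1)] lo a ab b by auto
  qed
  have right: "b = fst s \<and> fst s < fst q \<and> snd s < snd p \<and> snd s < snd q \<or>
      b = fst q \<and> fst q < fst s \<and> snd r < snd q \<and> snd s < snd q"
  proof (cases "fst s \<le> fst q")
    case True
    then show ?thesis using below(1)[OF P(4)] hi chord_finish[OF rs] a ab b by auto
  next
    case False
    then show ?thesis using above(2)[OF P(2)] hi chord_finish[OF pq] a ab b by auto
  qed
  \<comment> \<open>If both ends come from the same pair, it is the tall pair of a crossing; the
    mixed cases give contradictory heights.\<close>
  show ?thesis using left right pq rs ab unfolding crosses_def betw_def by auto
qed

lemma segments_Int:
  assumes d: "delaunay p q" "delaunay r s" and pq: "fst p < fst q" and rs: "fst r < fst s"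
    and nc: "\<not> crosses p q r s" "\<not> crosses r s p q" and ne: "(p, q) \<noteq> (r, s)"
    and z: "z \<in> closed_segment p q" "z \<in> closed_segment r s"
  shows "z \<in> {p, q} \<inter> {r, s}"
proof -
  have P: "p \<in> P" "q \<in> P" "r \<in> P" "s \<in> P" using d unfolding delaunay_def by auto
  note seg1 = closed_segment_iff_chord[OF pq] and seg2 = closed_segment_iff_chord[OF rs]
  define a where "a = max (fst p) (fst r)"
  define b where "b = min (fst q) (fst s)"
  have zx: "a \<le> fst z" "fst z \<le> b" and eq: "chord p q (fst z) = chord r s (fst z)"
    and sz: "snd z = chord p q (fst z)"
    using z unfolding seg1 seg2 a_def b_def by auto
  have "z \<in> P"
  proof (rule ccontr)
    assume "z \<notin> P"
    have "fst z \<noteq> fst p" "fst z \<noteq> fst q" "fst z \<noteq> fst r" "fst z \<noteq> fst s"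
      using \<open>z \<notin> P\<close> P sz eq chord_finish[OF pq] chord_finish[OF rs] chord_start by (metis prod_eqI)+
    then have ab: "a < fst z" "fst z < b" using zx unfolding a_def b_def by auto
    \<comment> \<open>The affine difference of the two chords vanishes at an interior point of the common range.\<close>
    let ?d = "\<lambda>x. chord r s x - chord p q x"
    have bal: "(b - fst z) * ?d a + (fst z - a) * ?d b = 0"
      using chord_affine[of b a p q "fst z"] chord_affine[of b a r s "fst z"] eq
      by (simp add: algebra_simps)
    consider "?d a > 0" | "?d a < 0" | "?d a = 0" by linarith
    then show False
    proof cases
      case 1
      then have "(fst z - a) * ?d b < 0" using bal ab mult_pos_pos[of "b - fst z" "?d a"] by linarith
      then have "?d b < 0" using ab by (simp add: mult_less_0_iff)
      then show False
        using chords_swap_crosses[OF d pq rs a_def b_def] 1 ab nc by auto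
    next
      case 2
      then have "(fst z - a) * ?d b > 0" using bal ab mult_pos_neg[of "b - fst z" "?d a"] by linarith
      then have "?d b > 0" using ab by (simp add: zero_less_mult_iff)
      then show False
        using chords_swap_crosses[OF d(2,1) rs pq, of a b] 2 ab nc unfolding a_def b_def
        by (auto simp: max.commute min.commute)
    next
      case 3
      then have db: "?d b = 0" using bal ab by simp
      \<comment> \<open>The chords agree at both ends of the range. The later of the two left
        endpoints thus lies on the other segment, and as a point of \<open>P\<close> it must be an
        endpoint there; \<open>a < b\<close> excludes the right one.\<close>
      have "p = r"
      proof (cases "fst p \<le> fst r")
        case True
        then have "r \<in> closed_segment p q" unfolding seg1 using 3 ab unfolding a_def b_def by auto
        then show ?thesis using delaunay_segment_Int[OF d(1) pq P(3)] ab unfolding a_def b_def by auto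
      next
        case False
        then have "p \<in> closed_segment r s" unfolding seg2 using 3 ab unfolding a_def b_def by auto
        then show ?thesis using delaunay_segment_Int[OF d(2) rs P(1)] ab unfolding a_def b_def by auto
      qed
      moreover have "q = s"
      proof (cases "fst s \<le> fst q")
        case True
        then have "s \<in> closed_segment p q"
          unfolding seg1 using db ab chord_finish[OF rs] unfolding a_def b_def by auto
        then show ?thesis using delaunay_segment_Int[OF d(1) pq P(4)] ab unfolding a_def b_def by auto
      next
        case False
        then have "q \<in> closed_segment r s"
          unfolding seg2 using db ab chord_finish[OF pq] unfolding a_def b_def by auto
        then show ?thesis using delaunay_segment_Int[OF d(2) rs P(2)] ab unfolding a_def b_def by auto
      qed
      ultimately show False using ne by simp
    qed
  qed
  then show ?thesis using delaunay_segment_Int d pq rs z by blast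
qed

theorem edges_planar: "planar_graph P {{p, q} | p q. edge p q}"
proof -
  define E where "E = {{p, q} | p q. edge p q}"
  \<comment> \<open>Each edge is oriented from left to right. This may reverse the pair given by
    \<open>edge\<close>, which is harmless as \<open>delaunay\<close> and \<open>crosses\<close> are
    symmetric within a pair.\<close>
  have "\<exists>pq. e = {fst pq, snd pq} \<and> fst (fst pq) < fst (snd pq) \<and>
      (edge (fst pq) (snd pq) \<or> edge (snd pq) (fst pq))" if e: "e \<in> E" for e
  proof -
    obtain p q where pq: "e = {p, q}" "edge p q" using e unfolding E_def by blast
    then have "fst p \<noteq> fst q"
      using inj_onD[OF inj_X] unfolding edge_def uncut_def delaunay_def by blast
    then consider "fst p < fst q" | "fst q < fst p" by linarith
    then show ?thesis
    proof cases
      case 1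
      then show ?thesis using pq by (intro exI[of _ "(p, q)"]) auto
    next
      case 2
      then show ?thesis using pq by (intro exI[of _ "(q, p)"]) auto
    qed
  qed
  then have "\<forall>e\<in>E. \<exists>pq. e = {fst pq, snd pq} \<and> fst (fst pq) < fst (snd pq) \<and>
      (edge (fst pq) (snd pq) \<or> edge (snd pq) (fst pq))" (is "\<forall>e\<in>E. \<exists>pq. ?ok e pq") by (rule ballI)
  from bchoice[OF this] obtain g where "\<forall>e\<in>E. ?ok e (g e)" by (rule exE)
  note g = bspec[OF this]
  define l where "l e = fst (g e)" for e
  define r where "r e = snd (g e)" for e
  have lr: "e = {l e, r e}" "fst (l e) < fst (r e)" "edge (l e) (r e) \<or> edge (r e) (l e)" if "e \<in> E" for e
    using g[OF that] unfolding l_def r_def by auto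
  have del: "delaunay (l e) (r e)" if "e \<in> E" for e
    using lr(3)[OF that] delaunay_sym unfolding edge_def uncut_def by blast
  have nc: "\<not> crosses (l e) (r e) (l e') (r e')" if "e \<in> E" "e' \<in> E" for e e'
    using lr(3)[OF that(1)] lr(3)[OF that(2)] edges_not_cross crosses_sym by metis
  let ?\<gamma> = "\<lambda>e. linepath (l e) (r e)"
  have "simple_graph P E"
    unfolding E_def simple_graph_def edge_def uncut_def delaunay_def by blast
  moreover have "arc (?\<gamma> e) \<and> {pathstart (?\<gamma> e), pathfinish (?\<gamma> e)} = id ` e \<and>
      path_image (?\<gamma> e) \<inter> id ` P = id ` e" if e: "e \<in> E" for e
  proof -
    have P: "l e \<in> P" "r e \<in> P" "l e \<noteq> r e" using del[OF e] unfolding delaunay_def by auto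
    have "closed_segment (l e) (r e) \<inter> P = {l e, r e}"
      using delaunay_segment_Int[OF del[OF e] lr(2)[OF e]] P by auto
    then have "closed_segment (l e) (r e) \<inter> P = e" "{l e, r e} = e" by (simp_all only: lr(1)[OF e, symmetric])
    then show ?thesis using arc_linepath[OF P(3)] by simp
  qed
  moreover have "path_image (?\<gamma> e) \<inter> path_image (?\<gamma> e') \<subseteq> id ` (e \<inter> e')"
    if e: "e \<in> E" "e' \<in> E" "e \<noteq> e'" for e e'
  proof -
    have "(l e, r e) \<noteq> (l e', r e')" using lr(1)[OF e(1)] lr(1)[OF e(2)] e(3) by (metis Pair_inject)
    then have "closed_segment (l e) (r e) \<inter> closed_segment (l e') (r e') \<subseteq> {l e, r e} \<inter> {l e', r e'}"
      using segments_Int[OF del[OF e(1)] del[OF e(2)] lr(2)[OF e(1)] lr(2)[OF e(2)] nc[OF e(1,2)] nc[OF e(2,1)]]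
      by blast
    then show ?thesis by (simp only: lr(1)[OF e(1), symmetric] lr(1)[OF e(2), symmetric] path_image_linepath image_id id_apply)
  qed
  ultimately show ?thesis
    unfolding E_def[symmetric] planar_graph_def by (intro conjI exI[of _ id] exI[of _ ?\<gamma>] ballI impI) auto
qed

end

section \<open>Colour classes and assembly of the planar graphs\<close>

lemma chromatic_colouring:
  assumes "finite V" and irrefl: "\<And>v. \<not> adj v v"
  obtains c where "proper_colouring V adj (chromatic_number V adj) c"
proof -
  obtain c :: "'a \<Rightarrow> nat" and n where c: "c ` V = {i. i < n}" "inj_on c V"
    using finite_imp_inj_to_nat_seg[OF assms(1)] by blast
  \<comment> \<open>An injective colouring is proper by irreflexivity, so the set under
    \<open>LEAST\<close> is nonempty and its minimum is attained.\<close>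
  then have "proper_colouring V adj n c"
    using irrefl unfolding proper_colouring_def inj_on_def by blast
  then have "\<exists>c. proper_colouring V adj (chromatic_number V adj) c"
    unfolding chromatic_number_def by (intro LeastI) (rule exI)
  then show thesis using that by blast
qed

lemma piercing_adjI:
  assumes "valid_rect R" "valid_rect S"
    and x: "rx1 S < rx1 R" "rx2 R < rx2 S" and y: "ry1 R < ry1 S" "ry2 S < ry2 R"
  shows "piercing_adj R S"
proof -
  \<comment> \<open>The common point takes its abscissa from the middle of the narrow
    \<open>R\<close> and its ordinate from the middle of the flat \<open>S\<close>.\<close>
  have "((rx1 R + rx2 R) / 2, (ry1 S + ry2 S) / 2) \<in> rect_set R \<inter> rect_set S"
    using assms unfolding rect_set_def in_rect_def valid_rect_def by auto
  then have "rect_set R \<inter> rect_set S \<noteq> {}" by blast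
  moreover have "R \<noteq> S" using x by auto
  moreover have "corners R \<inter> rect_set S = {}" "corners S \<inter> rect_set R = {}"
    using x y unfolding corners_def rect_set_def in_rect_def by auto
  ultimately show ?thesis unfolding piercing_adj_def by blast
qed

theorem theorem4:
  fixes P :: "point set" and \<R> :: "rect set" and k :: nat
  assumes "finite P" and "finite \<R>"
    and "\<forall>R\<in>\<R>. valid_rect R"
    and "general_position P \<R>"
    and "chromatic_number \<R> piercing_adj = k"
  shows "\<exists>G :: nat \<Rightarrow> point set set.
           (\<forall>i<k. planar_graph P (G i)) \<and>
           (\<forall>R\<in>\<R>. induced_connected (P \<inter> rect_set R) (\<Union>i<k. G i))"
proof -
  have "\<not> piercing_adj R R" for R unfolding piercing_adj_def by blast
  then obtain c where c: "proper_colouring \<R> piercing_adj k c"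
    using chromatic_colouring[OF assms(2), of piercing_adj] assms(5) by metis
  define F where "F i = {R \<in> \<R>. c R = i}" for i
  \<comment> \<open>A forbidden pair within one class would be adjacent in the piercing graph,
    against the colouring.\<close>
  have fam: "planar_rect_family P (F i) rx1 rx2 ry1 ry2" for i
  proof
    show "finite P" "inj_on fst P" "inj_on snd P"
      using assms(1,4) unfolding general_position_def by auto
    fix R S
    assume "R \<in> F i" "S \<in> F i" and "rx1 S < rx1 R" "rx2 R < rx2 S" "ry1 R < ry1 S" "ry2 S < ry2 R"
    then have "piercing_adj R S" "R \<in> \<R>" "S \<in> \<R>" "c R = c S"
      using piercing_adjI assms(3) unfolding F_def by auto
    then show False using c unfolding proper_colouring_def by blast
  qed
  then have fam': "rect_family P (F i) fst snd rx1 rx2 ry1 ry2" for i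
    unfolding planar_rect_family_def .
  define E where "E i = rect_family.edge P (F i) fst snd rx1 rx2 ry1 ry2" for i
  define G where "G i = {{p, q} | p q. E i p q}" for i
  have "planar_graph P (G i)" for i
    using planar_rect_family.edges_planar[OF fam] unfolding G_def E_def .
  moreover have "induced_connected (P \<inter> rect_set R) (\<Union>i<k. G i)" if R: "R \<in> \<R>" for R
  proof -
    \<comment> \<open>Reachability in the whole union; the edges from the class of \<open>R\<close>
      alone already make \<open>edge_support\<close> applicable.\<close>
    define T where "T = (\<lambda>a b. a \<in> P \<inter> rect_set R \<and> b \<in> P \<inter> rect_set R \<and> {a, b} \<in> (\<Union>i<k. G i))\<^sup>*\<^sup>*"
    interpret rect_family P "F (c R)" fst snd rx1 rx2 ry1 ry2 by (rule fam')
    have ck: "c R < k" using c R unfolding proper_colouring_def by blast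
    have mem: "mem z R \<longleftrightarrow> z \<in> rect_set R" for z
      unfolding mem_def rect_set_def in_rect_def by simp
    have "transp T" unfolding T_def by simp
    moreover have "symp T" unfolding T_def
      by (intro symp_rtranclp sympI) (simp add: insert_commute)
    moreover have "T a a" for a unfolding T_def by simp
    moreover have "T a b" if "edge a b" "mem a R" "mem b R" for a b
    proof -
      have "a \<in> P" "b \<in> P" using that(1) unfolding edge_def uncut_def delaunay_def by auto
      moreover have "{a, b} \<in> G (c R)" using that(1) unfolding G_def E_def by blast
      ultimately show ?thesis using that(2,3) ck unfolding T_def mem by blast
    qed
    moreover have "R \<in> F (c R)" using R unfolding F_def by blast
    ultimately have "T a b" if "a \<in> P" "b \<in> P" "mem a R" "mem b R" for a b
      using edge_support[of T R a b] that by blast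
    then show ?thesis unfolding induced_connected_def T_def mem by blast
  qed
  ultimately show ?thesis by blast
qed

end
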